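(* Let $\lambda,\mu,\nu$ be polynomial dominant weights of $GL_n$ with $\mu_i\le\lambda_i$ for all $i$. For $L\in LR(\lambda/\mu,\nu)$ define the $t$-array $U(L)=(u^{(k)}_j)_{1\le j\le k\le n}$ by $$u^{(k)}_j=\mu_{n-k+j}+\#\{\text{entries}\le n-k\text{ in row } n-k+j \text{ of } L\},$$ and let $\phi(L)=U(L)^*$ be its dual array. Then $\phi$ is a bijection from $LR(\lambda/\mu,\nu)$ onto $GZ(\mu^*,\lambda^*-\nu^*,\nu^* )$.
   Context: A polynomial dominant weight of $GL_n$ is a sequence of nonnegative integers $\lambda=(\lambda_1,\dots,\lambda_n)$ with $\lambda_1\ge\dots\ge\lambda_n$; its dual is $\lambda^*=(-\lambda_n,\dots,-\lambda_1)$; differences are componentwise. Tableaux are drawn in English convention; row $r$ of the skew shape $\lambda/\mu$ consists of the boxes in columns $\mu_r+1,\dots,\lambda_r$. A tableau on $\lambda/\mu$ (filling of its boxes with positive integers) is an LR tableau if (1) it is semistandard: entries weakly increase left to right along rows and strictly increase top to bottom down columns; and (2) its reverse reading word is Yamanouchi: if $x_1x_2\cdots x_r$ is the word obtained by reading entries left to right in each row, starting from the bottom row and going up, then for every $s$ the word $x_rx_{r-1}\cdots x_s$ contains at least as many $a$'s as $(a+1)$'s for every $a\ge1$. Its content is $\nu$ if the entry $k$ appears exactly $\nu_k$ times for each $k$ (so entries lie in $\{1,\dots,n\}$). $LR(\lambda/\mu,\nu)$ denotes the set of LR tableaux of shape $\lambda/\mu$ and content $\nu$. A $t$-array is an integer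 array $T=(t^{(i)}_j)_{1\le j\le i\le n}$; its type is its $n$-th row $(t^{(n)}_1,\dots,t^{(n)}_n)$; its weight is $(w_1,\dots,w_n)$ with $w_1=t^{(1)}_1$, $w_i=\sum_{k=1}^i t^{(i)}_k-\sum_{k=1}^{i-1}t^{(i-1)}_k$ for $i\ge2$; its dual array is $T^*=(s^{(i)}_j)$ with $s^{(i)}_j=-t^{(i)}_{i+1-j}$. $T$ is a GT pattern if $t^{(i+1)}_j\ge t^{(i)}_j$ and $t^{(i)}_j\ge t^{(i+1)}_{j+1}$ for all $1\le j\le i\le n-1$. Its exponents are $\varepsilon^{(i)}_j(T)=\sum_{1\le h<j}(t^{(i+1)}_h-2t^{(i)}_h+t^{(i-1)}_h)+(t^{(i+1)}_j-t^{(i)}_j)$ for $1\le j\le i\le n-1$. For weakly decreasing $\alpha,\gamma\in\mathbb{Z}^n$ and $\beta\in\mathbb{Z}^n$, $GZ(\alpha,\beta,\gamma)$ is the set of GT patterns of type $\alpha$ and weight $\beta$ with $\varepsilon^{(i)}_j(T)\le\gamma_i-\gamma_{i+1}$ for all $1\le j\le i\le n-1$. *)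

theory Defs
  imports Complex_Main "HOL-Library.FuncSet"
begin

section \<open>Weights\<close>

text \<open>An element of \<open>\<int>\<^sup>n\<close> is a function \<open>nat \<Rightarrow> int\<close> of which only the values at the
  arguments \<open>1, \<dots>, n\<close> are ever used.\<close>

definition polynomial_dominant_weight :: "nat \<Rightarrow> (nat \<Rightarrow> int) \<Rightarrow> bool" where
  "polynomial_dominant_weight n a \<longleftrightarrow>
     antimono_on {1..n} a \<and> (\<forall>i\<in>{1..n}. 0 \<le> a i)"

definition dual_weight :: "nat \<Rightarrow> (nat \<Rightarrow> int) \<Rightarrow> nat \<Rightarrow> int" where
  "dual_weight n a i = - a (n + 1 - i)"


section \<open>Littlewood-Richardson tableaux\<close>

text \<open>The box in row \<open>r\<close> (counted from the top) and column \<open>c\<close> is \<open>(r, c)\<close>.\<close>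

definition skew_shape :: "nat \<Rightarrow> (nat \<Rightarrow> int) \<Rightarrow> (nat \<Rightarrow> int) \<Rightarrow> (nat \<times> int) set" where
  "skew_shape n lam mu = {(r, c). r \<in> {1..n} \<and> c \<in> {mu r + 1..lam r}}"

text \<open>Fillings take the value \<open>undefined\<close> off the shape, so that two tableaux are equal as
  functions iff they have the same entries.\<close>

definition tableaux :: "nat \<Rightarrow> (nat \<Rightarrow> int) \<Rightarrow> (nat \<Rightarrow> int) \<Rightarrow> (nat \<times> int \<Rightarrow> nat) set" where
  "tableaux n lam mu = skew_shape n lam mu \<rightarrow>\<^sub>E {1..}"

definition semistandard ::
    "nat \<Rightarrow> (nat \<Rightarrow> int) \<Rightarrow> (nat \<Rightarrow> int) \<Rightarrow> (nat \<times> int \<Rightarrow> nat) \<Rightarrow> bool" where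
  "semistandard n lam mu L \<longleftrightarrow>
     (\<forall>r c c'. (r, c) \<in> skew_shape n lam mu \<and> (r, c') \<in> skew_shape n lam mu \<and> c < c'
        \<longrightarrow> L (r, c) \<le> L (r, c')) \<and>
     (\<forall>r r' c. (r, c) \<in> skew_shape n lam mu \<and> (r', c) \<in> skew_shape n lam mu \<and> r < r'
        \<longrightarrow> L (r, c) < L (r', c))"

definition reading_word ::
    "nat \<Rightarrow> (nat \<Rightarrow> int) \<Rightarrow> (nat \<Rightarrow> int) \<Rightarrow> (nat \<times> int \<Rightarrow> nat) \<Rightarrow> nat list" where
  "reading_word n lam mu L =
     concat (map (\<lambda>r. map (\<lambda>c. L (r, c)) [mu r + 1..lam r]) (rev [1..<n + 1]))"

definition yamanouchi :: "nat list \<Rightarrow> bool" where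
  "yamanouchi w \<longleftrightarrow>
     (\<forall>s. \<forall>a\<ge>1. count_list (take s w) (a + 1) \<le> count_list (take s w) a)"

definition has_content ::
    "nat \<Rightarrow> (nat \<Rightarrow> int) \<Rightarrow> (nat \<Rightarrow> int) \<Rightarrow> (nat \<times> int \<Rightarrow> nat) \<Rightarrow> (nat \<Rightarrow> int) \<Rightarrow> bool" where
  "has_content n lam mu L nu \<longleftrightarrow>
     L ` skew_shape n lam mu \<subseteq> {1..n} \<and>
     (\<forall>k\<in>{1..n}. int (card {b \<in> skew_shape n lam mu. L b = k}) = nu k)"

definition LR ::
    "nat \<Rightarrow> (nat \<Rightarrow> int) \<Rightarrow> (nat \<Rightarrow> int) \<Rightarrow> (nat \<Rightarrow> int) \<Rightarrow> (nat \<times> int \<Rightarrow> nat) set" where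
  "LR n lam mu nu =
     {L \<in> tableaux n lam mu.
        semistandard n lam mu L \<and>
        yamanouchi (rev (reading_word n lam mu L)) \<and>
        has_content n lam mu L nu}"


section \<open>Arrays and Gelfand-Tsetlin patterns\<close>

text \<open>The entry \<open>t\<^sup>(\<^sup>i\<^sup>)\<^sub>j\<close> is written \<open>T (i, j)\<close>. As for tableaux,
  arrays take the value \<open>undefined\<close> outside the index triangle.\<close>

definition triangle :: "nat \<Rightarrow> (nat \<times> nat) set" where
  "triangle n = {(i, j). 1 \<le> j \<and> j \<le> i \<and> i \<le> n}"

definition t_arrays :: "nat \<Rightarrow> (nat \<times> nat \<Rightarrow> int) set" where
  "t_arrays n = triangle n \<rightarrow>\<^sub>E UNIV"

text \<open>For \<open>i = 1\<close> the second sum is empty and the weight component is \<open>T (1, 1)\<close>.\<close>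

definition array_weight :: "(nat \<times> nat \<Rightarrow> int) \<Rightarrow> nat \<Rightarrow> int" where
  "array_weight T i = (\<Sum>k=1..i. T (i, k)) - (\<Sum>k=1..i - 1. T (i - 1, k))"

definition dual_array :: "nat \<Rightarrow> (nat \<times> nat \<Rightarrow> int) \<Rightarrow> nat \<times> nat \<Rightarrow> int" where
  "dual_array n T = (\<lambda>(i, j) \<in> triangle n. - T (i, i + 1 - j))"

definition gt_pattern :: "nat \<Rightarrow> (nat \<times> nat \<Rightarrow> int) \<Rightarrow> bool" where
  "gt_pattern n T \<longleftrightarrow>
     (\<forall>i j. 1 \<le> j \<and> j \<le> i \<and> i \<le> n - 1 \<longrightarrow>
        T (i + 1, j) \<ge> T (i, j) \<and> T (i, j) \<ge> T (i + 1, j + 1))"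

text \<open>Used for \<open>1 \<le> j \<le> i \<le> n - 1\<close> only; then all the entries involved lie in the triangle.\<close>

definition exponent :: "(nat \<times> nat \<Rightarrow> int) \<Rightarrow> nat \<Rightarrow> nat \<Rightarrow> int" where
  "exponent T i j =
     (\<Sum>h=1..<j. T (i + 1, h) - 2 * T (i, h) + T (i - 1, h)) + (T (i + 1, j) - T (i, j))"

definition GZ ::
    "nat \<Rightarrow> (nat \<Rightarrow> int) \<Rightarrow> (nat \<Rightarrow> int) \<Rightarrow> (nat \<Rightarrow> int) \<Rightarrow> (nat \<times> nat \<Rightarrow> int) set" where
  "GZ n \<alpha> \<beta> \<gamma> =
     {T \<in> t_arrays n.
        gt_pattern n T \<and>
        (\<forall>j\<in>{1..n}. T (n, j) = \<alpha> j) \<and>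
        (\<forall>i\<in>{1..n}. array_weight T i = \<beta> i) \<and>
        (\<forall>i j. 1 \<le> j \<and> j \<le> i \<and> i \<le> n - 1 \<longrightarrow> exponent T i j \<le> \<gamma> i - \<gamma> (i + 1))}"


section \<open>The map from tableaux to arrays\<close>

definition U_array ::
    "nat \<Rightarrow> (nat \<Rightarrow> int) \<Rightarrow> (nat \<Rightarrow> int) \<Rightarrow> (nat \<times> int \<Rightarrow> nat) \<Rightarrow> nat \<times> nat \<Rightarrow> int" where
  "U_array n lam mu L =
     (\<lambda>(k, j) \<in> triangle n.
        mu (n - k + j) +
        int (card {c. (n - k + j, c) \<in> skew_shape n lam mu \<and> L (n - k + j, c) \<le> n - k}))"

definition phi ::
    "nat \<Rightarrow> (nat \<Rightarrow> int) \<Rightarrow> (nat \<Rightarrow> int) \<Rightarrow> (nat \<times> int \<Rightarrow> nat) \<Rightarrow> nat \<times> nat \<Rightarrow> int" where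
  "phi n lam mu L = dual_array n (U_array n lam mu L)"

end

theory Submission
  imports Defs
begin

text \<open>
  A tableau with weakly increasing rows is determined by the numbers \<open>p r m\<close>, the last column of
  row \<open>r\<close> holding an entry \<open>\<le> m\<close> (or \<open>mu r\<close> if there is none). In these coordinates all the LR
  conditions are linear: columns are strict iff \<open>p (r + 1) (m + 1) \<le> p r m\<close>, and the Yamanouchi
  condition, which has to be tested only when all the letters \<open>a + 1\<close> of a row have just been
  read, says that the first \<open>R\<close> rows contain at most as many \<open>a + 1\<close> as the first \<open>R - 1\<close> rows
  contain \<open>a\<close>. In particular row \<open>r\<close> has no entry above \<open>r\<close>, so \<open>p r m = lam r\<close> for \<open>m \<ge> r\<close>, and
  the remaining coordinates are the entries of \<open>phi L\<close> up to sign: its \<open>(i, j)\<close> entry is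
  \<open>- p (n + 1 - j) (n - i)\<close>. Given the content, subtracting the Yamanouchi inequality from
  \<open>nu a - nu (a + 1)\<close> turns it into the bound on an exponent.
\<close>

section \<open>Yamanouchi words composed of weakly decreasing blocks\<close>

text \<open>For fixed \<open>a\<close>, the worst cut inside the block \<open>v\<close> comes right
  after its letters \<open>a + 1\<close>: by then all of them have been read, but no
  \<open>a\<close> of \<open>v\<close> yet.\<close>

lemma yamanouchi_append_decreasing:
  assumes "sorted_wrt (\<ge>) v"
  shows "yamanouchi (w @ v) \<longleftrightarrow>
    yamanouchi w \<and> (\<forall>a\<ge>1. count_list (w @ v) (a + 1) \<le> count_list w a)"
proof (intro iffI conjI allI impI)
  assume Y: "yamanouchi (w @ v)"
  show "yamanouchi w"
    unfolding yamanouchi_def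
  proof (intro allI impI)
    fix s a :: nat assume "a \<ge> 1"
    have "take s w = take (min s (length w)) (w @ v)"
      by (cases "s \<le> length w") auto
    then show "count_list (take s w) (a + 1) \<le> count_list (take s w) a"
      using Y \<open>a \<ge> 1\<close> unfolding yamanouchi_def by metis
  qed
  fix a :: nat assume "a \<ge> 1"
  \<comment> \<open>The prefix \<open>w @ u\<close> is the worst cut: since \<open>v\<close>
    decreases, \<open>u\<close> holds every \<open>a + 1\<close> of \<open>v\<close> and no
    \<open>a\<close>.\<close>
  define u where "u = takeWhile (\<lambda>x. a + 1 \<le> x) v"
  have pre: "w @ u = take (length (w @ u)) (w @ v)"
    by (simp add: u_def takeWhile_eq_take[symmetric])
  have "count_list u a = 0"
    by (auto simp: u_def count_list_0_iff dest: set_takeWhileD)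
  moreover have "count_list u (a + 1) = count_list v (a + 1)"
    using assms unfolding u_def
  proof (induction v)
    case (Cons x v)
    then show ?case
      by (cases "a + 1 \<le> x") (auto simp: count_list_0_iff)
  qed simp
  moreover have "count_list (w @ u) (a + 1) \<le> count_list (w @ u) a"
    using Y \<open>a \<ge> 1\<close> pre unfolding yamanouchi_def by metis
  ultimately show "count_list (w @ v) (a + 1) \<le> count_list w a" by simp
next
  assume H: "yamanouchi w \<and> (\<forall>a\<ge>1. count_list (w @ v) (a + 1) \<le> count_list w a)"
  show "yamanouchi (w @ v)"
    unfolding yamanouchi_def
  proof (intro allI impI)
    fix s a :: nat assume a: "a \<ge> 1"
    show "count_list (take s (w @ v)) (a + 1) \<le> count_list (take s (w @ v)) a"
    proof (cases "s \<le> length w")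
      case True
      then show ?thesis using H a by (auto simp: yamanouchi_def)
    next
      case False
      then have eq: "take s (w @ v) = w @ take (s - length w) v" by simp
      \<comment> \<open>Any cut inside \<open>v\<close> is compared with the worst one: it has no
        more letters \<open>a + 1\<close> than \<open>w @ v\<close>, and no fewer letters
        \<open>a\<close> than \<open>w\<close>.\<close>
      have "count_list (take (s - length w) v) (a + 1) \<le> count_list v (a + 1)"
        by (metis append_take_drop_id count_list_append le_add1)
      then have "count_list (take s (w @ v)) (a + 1) \<le> count_list (w @ v) (a + 1)"
        unfolding eq by simp
      also have "\<dots> \<le> count_list w a" using H a by blast
      also have "\<dots> \<le> count_list (take s (w @ v)) a" unfolding eq by simp
      finally show ?thesis .
    qed
  qed
qed

lemma count_list_concat_upt:
  "count_list (concat (map f [1..<n + 1])) a = (\<Sum>r=1..n. count_list (f r) a)"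
  by (induction n) auto

text \<open>Each block contributes one family of inequalities, at \<open>R\<close>. The right-hand
  sum stops before \<open>R\<close> because within a decreasing block the letters \<open>a\<close>
  follow the letters \<open>a + 1\<close>.\<close>

lemma yamanouchi_concat_decreasing:
  assumes "\<forall>r\<in>{1..n}. sorted_wrt (\<ge>) (f r)"
  shows "yamanouchi (concat (map f [1..<n + 1])) \<longleftrightarrow>
    (\<forall>R\<in>{1..n}. \<forall>a\<ge>1. (\<Sum>r=1..R. count_list (f r) (a + 1)) \<le> (\<Sum>r=1..<R. count_list (f r) a))"
  using assms
proof (induction n)
  case 0
  then show ?case by (simp add: yamanouchi_def)
next
  case (Suc n)
  have split: "concat (map f [1..<Suc n + 1]) = concat (map f [1..<n + 1]) @ f (Suc n)"
    by simp
  have "yamanouchi (concat (map f [1..<Suc n + 1])) \<longleftrightarrow>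
      yamanouchi (concat (map f [1..<n + 1])) \<and>
      (\<forall>a\<ge>1. count_list (concat (map f [1..<Suc n + 1])) (a + 1)
         \<le> count_list (concat (map f [1..<n + 1])) a)"
    unfolding split by (rule yamanouchi_append_decreasing) (use Suc.prems in auto)
  also have "\<dots> \<longleftrightarrow> (\<forall>R\<in>{1..n}. \<forall>a\<ge>1. (\<Sum>r=1..R. count_list (f r) (a + 1))
         \<le> (\<Sum>r=1..<R. count_list (f r) a)) \<and>
      (\<forall>a\<ge>1. (\<Sum>r=1..Suc n. count_list (f r) (a + 1)) \<le> (\<Sum>r=1..<Suc n. count_list (f r) a))"
    unfolding count_list_concat_upt using Suc
    by (simp add: atLeastLessThanSuc_atLeastAtMost)
  also have "\<dots> \<longleftrightarrow> (\<forall>R\<in>{1..Suc n}. \<forall>a\<ge>1. (\<Sum>r=1..R. count_list (f r) (a + 1))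
         \<le> (\<Sum>r=1..<R. count_list (f r) a))"
    by (auto simp: atLeastAtMostSuc_conv)
  finally show ?case .
qed

section \<open>Row ends as coordinates of a tableau\<close>

lemma int_down_closed_eq_atLeastAtMost:
  fixes S :: "int set"
  assumes "S \<subseteq> {a + 1..b}" and "\<And>c c'. c' \<in> S \<Longrightarrow> a + 1 \<le> c \<Longrightarrow> c \<le> c' \<Longrightarrow> c \<in> S"
  shows "S = {a + 1..a + int (card S)}"
proof (cases "S = {}")
  case False
  have fin: "finite S" using assms(1) finite_subset by blast
  then have M: "Max S \<in> S" using False by simp
  have eq: "S = {a + 1..Max S}"
  proof
    show "S \<subseteq> {a + 1..Max S}" using assms(1) Max_ge[OF fin] by fastforce
    show "{a + 1..Max S} \<subseteq> S" using assms(2)[OF M] by auto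
  qed
  have "a + 1 \<le> Max S" using M assms(1) by auto
  moreover have "card S = card {a + 1..Max S}" using eq by (rule arg_cong)
  ultimately have "a + int (card S) = Max S" by simp
  then show ?thesis using eq by simp
qed simp

text \<open>The count in \<open>U_array\<close> without the triangle restriction:
  \<open>U_array\<close> at \<open>(k, j)\<close> is this value for row \<open>n - k + j\<close> and
  level \<open>n - k\<close>.\<close>

definition row_end ::
    "nat \<Rightarrow> (nat \<Rightarrow> int) \<Rightarrow> (nat \<Rightarrow> int) \<Rightarrow> (nat \<times> int \<Rightarrow> nat) \<Rightarrow> nat \<Rightarrow> nat \<Rightarrow> int" where
  "row_end n lam mu L r m =
     mu r + int (card {c. (r, c) \<in> skew_shape n lam mu \<and> L (r, c) \<le> m})"

text \<open>Stated for arbitrary \<open>p\<close>, so that it serves both for the row ends of a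
  given tableau and for a tableau built from prescribed row ends.\<close>

definition has_row_ends ::
    "nat \<Rightarrow> (nat \<Rightarrow> int) \<Rightarrow> (nat \<Rightarrow> int) \<Rightarrow> (nat \<times> int \<Rightarrow> nat) \<Rightarrow> (nat \<Rightarrow> nat \<Rightarrow> int) \<Rightarrow> bool" where
  "has_row_ends n lam mu L p \<longleftrightarrow>
     (\<forall>r\<in>{1..n}. (\<forall>m. mu r \<le> p r m \<and> p r m \<le> lam r \<and> p r m \<le> p r (m + 1)) \<and>
       (\<forall>c\<in>{mu r + 1..lam r}. \<forall>m. L (r, c) \<le> m \<longleftrightarrow> c \<le> p r m))"

text \<open>Rows increase weakly, so the entries \<open>\<le> m\<close> fill an initial segment of
  the row, and their number determines where it ends.\<close>

lemma has_row_ends_row_end: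
  assumes "semistandard n lam mu L" and le: "\<forall>r\<in>{1..n}. mu r \<le> lam r"
  shows "has_row_ends n lam mu L (row_end n lam mu L)"
  unfolding has_row_ends_def
proof (intro ballI)
  fix r assume r: "r \<in> {1..n}"
  define S where "S m = {c. (r, c) \<in> skew_shape n lam mu \<and> L (r, c) \<le> m}" for m
  have sub: "S m \<subseteq> {mu r + 1..lam r}" for m
    by (auto simp: S_def skew_shape_def)
  have eq: "S m = {mu r + 1..row_end n lam mu L r m}" for m
    unfolding row_end_def S_def[symmetric]
  proof (rule int_down_closed_eq_atLeastAtMost[OF sub])
    fix c c' assume c: "c' \<in> S m" "mu r + 1 \<le> c" "c \<le> c'"
    then have "(r, c) \<in> skew_shape n lam mu" by (auto simp: S_def skew_shape_def)
    moreover from this have "L (r, c) \<le> L (r, c')"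
      using assms(1) c by (cases "c = c'") (auto simp: S_def semistandard_def)
    ultimately show "c \<in> S m" using c by (auto simp: S_def)
  qed
  have ge: "mu r \<le> row_end n lam mu L r m" for m
    by (simp add: row_end_def)
  have up: "row_end n lam mu L r m \<le> lam r" for m
    using sub[of m] ge[of m] le r unfolding eq by (fastforce simp: atLeastatMost_subset_iff)
  have "S m \<subseteq> S (m + 1)" for m by (auto simp: S_def)
  then have "row_end n lam mu L r m \<le> row_end n lam mu L r (m + 1)" for m
    using ge[of "m + 1"] unfolding eq atLeastatMost_subset_iff by (smt (verit))
  moreover have "L (r, c) \<le> m \<longleftrightarrow> c \<le> row_end n lam mu L r m" if "c \<in> {mu r + 1..lam r}" for c m
  proof -
    have "L (r, c) \<le> m \<longleftrightarrow> c \<in> S m" using that r by (auto simp: S_def skew_shape_def)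
    then show ?thesis using that unfolding eq by auto
  qed
  ultimately show "(\<forall>m. mu r \<le> row_end n lam mu L r m \<and> row_end n lam mu L r m \<le> lam r
      \<and> row_end n lam mu L r m \<le> row_end n lam mu L r (m + 1)) \<and>
    (\<forall>c\<in>{mu r + 1..lam r}. \<forall>m. L (r, c) \<le> m \<longleftrightarrow> c \<le> row_end n lam mu L r m)"
    using ge up by blast
qed

text \<open>Row ends are unique within the rows of the shape; this evaluates \<open>phi\<close> on a
  tableau constructed from prescribed row ends.\<close>

lemma row_end_eqI:
  assumes "has_row_ends n lam mu L p" and "r \<in> {1..n}"
  shows "row_end n lam mu L r m = p r m"
proof -
  have p: "mu r \<le> p r m" "p r m \<le> lam r" using assms by (auto simp: has_row_ends_def)
  have "L (r, c) \<le> m \<longleftrightarrow> c \<le> p r m" if "c \<in> {mu r + 1..lam r}" for c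
    using assms that unfolding has_row_ends_def by blast
  then have "{c. (r, c) \<in> skew_shape n lam mu \<and> L (r, c) \<le> m} = {mu r + 1..p r m}"
    using assms(2) p by (auto simp: skew_shape_def)
  then show ?thesis using p by (simp add: row_end_def)
qed

lemma has_row_ends_level_set:
  assumes "has_row_ends n lam mu L p" and "r \<in> {1..n}"
  shows "{c \<in> {mu r + 1..lam r}. L (r, c) = a + 1} = {p r a + 1..p r (a + 1)}"
proof -
  have p: "mu r \<le> p r a" "p r (a + 1) \<le> lam r" using assms unfolding has_row_ends_def by blast+
  have "L (r, c) = a + 1 \<longleftrightarrow> \<not> L (r, c) \<le> a \<and> L (r, c) \<le> a + 1" for c by auto
  moreover have "L (r, c) \<le> m \<longleftrightarrow> c \<le> p r m" if "c \<in> {mu r + 1..lam r}" for c m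
    using assms that unfolding has_row_ends_def by blast
  ultimately show ?thesis using p by (intro set_eqI) (smt (verit) atLeastAtMost_iff mem_Collect_eq)
qed

lemma card_level_set:
  assumes "has_row_ends n lam mu L p" and "r \<in> {1..n}"
  shows "int (card {c \<in> {mu r + 1..lam r}. L (r, c) = a + 1}) = p r (a + 1) - p r a"
proof -
  have "p r a \<le> p r (a + 1)" using assms unfolding has_row_ends_def by blast
  then show ?thesis unfolding has_row_ends_level_set[OF assms] by simp
qed

section \<open>The word and content conditions in terms of row ends\<close>

lemma count_list_map_distinct:
  assumes "distinct xs"
  shows "count_list (map f xs) a = card {x \<in> set xs. f x = a}"
  using assms
proof (induction xs)
  case (Cons x xs)
  have "{y \<in> set (x # xs). f y = a} =
      (if f x = a then insert x {y \<in> set xs. f y = a} else {y \<in> set xs. f y = a})"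
    by auto
  then show ?case using Cons by (simp add: card_insert_if)
qed simp

text \<open>The reversed word reads the rows from top to bottom, each from right to left, hence as
  weakly decreasing blocks. Letters are written \<open>a + 1\<close> and \<open>a + 2\<close> so
  that \<open>a\<close> ranges over all naturals.\<close>

lemma yamanouchi_reading_word_iff:
  assumes "has_row_ends n lam mu L p"
  shows "yamanouchi (rev (reading_word n lam mu L)) \<longleftrightarrow>
    (\<forall>R\<in>{1..n}. \<forall>a. (\<Sum>r=1..R. p r (a + 2) - p r (a + 1)) \<le> (\<Sum>r=1..<R. p r (a + 1) - p r a))"
proof -
  define f where "f r = rev (map (\<lambda>c. L (r, c)) [mu r + 1..lam r])" for r
  have word: "rev (reading_word n lam mu L) = concat (map f [1..<n + 1])"
    by (simp add: reading_word_def rev_concat rev_map f_def[abs_def] o_def)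
  have sorted: "\<forall>r\<in>{1..n}. sorted_wrt (\<ge>) (f r)"
  proof
    fix r assume r: "r \<in> {1..n}"
    have "L (r, c) \<le> L (r, c')" if "c \<in> {mu r + 1..lam r}" "c' \<in> {mu r + 1..lam r}" "c \<le> c'" for c c'
    proof -
      \<comment> \<open>The row-end equivalence is used at the level \<open>L (r, c')\<close>, first
        for \<open>c'\<close> and then for the smaller column \<open>c\<close>.\<close>
      have "c' \<le> p r (L (r, c'))" using assms r that unfolding has_row_ends_def by blast
      then show ?thesis using assms r that unfolding has_row_ends_def by (meson order_trans)
    qed
    then show "sorted_wrt (\<ge>) (f r)"
      unfolding f_def sorted_wrt_rev sorted_wrt_map
      by (intro sorted_wrt_mono_rel[OF _ sorted_upto]) simp
  qed
  have count: "int (count_list (f r) (a + 1)) = p r (a + 1) - p r a" if "r \<in> {1..n}" for r a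
    using card_level_set[OF assms that, of a] by (simp add: f_def count_list_map_distinct)
  have cnt: "int (\<Sum>r\<in>A. count_list (f r) (a + 1)) = (\<Sum>r\<in>A. p r (a + 1) - p r a)"
    if "A \<subseteq> {1..n}" for A a
    unfolding of_nat_sum using that by (intro sum.cong[OF refl] count) auto
  have all: "(\<forall>a\<ge>1. P a) \<longleftrightarrow> (\<forall>a. P (a + 1))" for P :: "nat \<Rightarrow> bool"
    by (auto simp: Suc_le_eq gr0_conv_Suc)
  have "yamanouchi (rev (reading_word n lam mu L)) \<longleftrightarrow> (\<forall>R\<in>{1..n}. \<forall>a.
      int (\<Sum>r=1..R. count_list (f r) (a + 1 + 1)) \<le> int (\<Sum>r=1..<R. count_list (f r) (a + 1)))"
    unfolding word yamanouchi_concat_decreasing[OF sorted] all by (simp only: of_nat_le_iff)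
  also have "\<dots> \<longleftrightarrow> (\<forall>R\<in>{1..n}. \<forall>a.
      (\<Sum>r=1..R. p r (a + 1 + 1) - p r (a + 1)) \<le> (\<Sum>r=1..<R. p r (a + 1) - p r a))"
  proof (intro ball_cong[OF refl] arg_cong[of _ _ All] ext)
    fix R a assume "R \<in> {1..n}"
    then have "{1..R} \<subseteq> {1..n}" "{1..<R} \<subseteq> {1..n}" by auto
    then show "(int (\<Sum>r=1..R. count_list (f r) (a + 1 + 1)) \<le> int (\<Sum>r=1..<R. count_list (f r) (a + 1)))
      = ((\<Sum>r=1..R. p r (a + 1 + 1) - p r (a + 1)) \<le> (\<Sum>r=1..<R. p r (a + 1) - p r a))"
      by (simp only: cnt)
  qed
  finally show ?thesis by (simp add: add.assoc)
qed

lemma card_shape_level_set: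
  assumes "has_row_ends n lam mu L p"
  shows "int (card {b \<in> skew_shape n lam mu. L b = a + 1}) = (\<Sum>r=1..n. p r (a + 1) - p r a)"
proof -
  have fin: "finite {c \<in> {mu r + 1..lam r}. L (r, c) = a + 1}" for r
    by (rule finite_subset[of _ "{mu r + 1..lam r}"]) auto
  have "{b \<in> skew_shape n lam mu. L b = a + 1} =
      (SIGMA r:{1..n}. {c \<in> {mu r + 1..lam r}. L (r, c) = a + 1})"
    by (auto simp: skew_shape_def)
  then have "card {b \<in> skew_shape n lam mu. L b = a + 1} =
      (\<Sum>r=1..n. card {c \<in> {mu r + 1..lam r}. L (r, c) = a + 1})"
    by (simp only:) (intro card_SigmaI ballI fin finite_atLeastAtMost)
  then have "int (card {b \<in> skew_shape n lam mu. L b = a + 1}) =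
      (\<Sum>r=1..n. int (card {c \<in> {mu r + 1..lam r}. L (r, c) = a + 1}))"
    by (simp only: of_nat_sum)
  also have "\<dots> = (\<Sum>r=1..n. p r (a + 1) - p r a)"
    by (intro sum.cong[OF refl] card_level_set[OF assms])
  finally show ?thesis .
qed

section \<open>From LR tableaux to profiles\<close>

text \<open>In order, the clauses encode: positive entries; no entry above \<open>r\<close> in row
  \<open>r\<close>; nonnegative multiplicities in each row; strict columns; content; the Yamanouchi
  condition.\<close>

definition LR_profile ::
    "nat \<Rightarrow> (nat \<Rightarrow> int) \<Rightarrow> (nat \<Rightarrow> int) \<Rightarrow> (nat \<Rightarrow> int) \<Rightarrow> (nat \<Rightarrow> nat \<Rightarrow> int) \<Rightarrow> bool" where
  "LR_profile n lam mu nu p \<longleftrightarrow>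
     (\<forall>r\<in>{1..n}. p r 0 = mu r) \<and>
     (\<forall>r\<in>{1..n}. \<forall>m\<ge>r. p r m = lam r) \<and>
     (\<forall>r\<in>{1..n}. \<forall>m. p r m \<le> p r (m + 1)) \<and>
     (\<forall>r\<in>{1..<n}. \<forall>m. p (r + 1) (m + 1) \<le> p r m) \<and>
     (\<forall>a<n. (\<Sum>r=1..n. p r (a + 1) - p r a) = nu (a + 1)) \<and>
     (\<forall>R\<in>{1..n}. \<forall>a. (\<Sum>r=1..R. p r (a + 2) - p r (a + 1)) \<le> (\<Sum>r=1..<R. p r (a + 1) - p r a))"

text \<open>By the Yamanouchi condition, the letters \<open>m + 1\<close> in row \<open>R\<close>
  are at most as many as the letters \<open>m\<close> in the rows above it. For
  \<open>m \<ge> R\<close> there are none of the latter, by induction on \<open>R\<close>.\<close>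

lemma row_end_flagged:
  assumes ends: "has_row_ends n lam mu L p"
    and yam: "yamanouchi (rev (reading_word n lam mu L))"
    and content: "L ` skew_shape n lam mu \<subseteq> {1..n}"
    and r: "r \<in> {1..n}" "r \<le> m"
  shows "p r m = lam r"
proof -
  have top: "p r m = lam r" if "r \<in> {1..n}" "n \<le> m" for r m
  proof (cases "mu r < lam r")
    case True
    then have "(r, lam r) \<in> skew_shape n lam mu" using that by (auto simp: skew_shape_def)
    then have "L (r, lam r) \<le> m" using content that by fastforce
    then have "lam r \<le> p r m" using ends that True unfolding has_row_ends_def by auto
    then show ?thesis using ends that unfolding has_row_ends_def by (metis order_antisym)
  next
    case False
    have "mu r \<le> p r m" "p r m \<le> lam r" using ends that unfolding has_row_ends_def by blast+
    then show ?thesis using False by linarith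
  qed
  have mono: "p r m \<le> p r (m + 1)" if "r \<in> {1..n}" for r m
    using ends that unfolding has_row_ends_def by blast
  have step: "p R (m + 1) - p R m = 0" if "R \<in> {1..n}" "R \<le> m" for R m
    using that
  proof (induction R arbitrary: m rule: less_induct)
    case (less R)
    obtain a where m: "m = a + 1" using less.prems by (metis Suc_eq_plus1 Suc_le_D atLeastAtMost_iff One_nat_def le_trans)
    have "p R (m + 1) - p R m \<le> (\<Sum>r=1..R. p r (m + 1) - p r m)"
      using less.prems mono by (intro member_le_sum) (auto)
    also have "\<dots> \<le> (\<Sum>r=1..<R. p r (a + 1) - p r a)"
      using yam less.prems unfolding yamanouchi_reading_word_iff[OF ends] m by (simp add: add.assoc)
    also have "\<dots> = 0"
      using less by (intro sum.neutral) (auto simp: m)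
    finally show ?case using mono[OF less.prems(1), of m] by linarith
  qed
  have "p r m = p r (m + k)" for k
  proof (induction k)
    case (Suc k)
    then show ?case using step[of r "m + k"] r by simp
  qed simp
  \<comment> \<open>The row end is constant from level \<open>r\<close> on, and at level
    \<open>m + n\<close> it is \<open>lam r\<close> because all entries are at most
    \<open>n\<close>.\<close>
  from this[of n] show ?thesis using top[of r "m + n"] r by simp
qed

lemma LR_profile_row_end:
  assumes lam: "antimono_on {1..n} lam" and mu: "antimono_on {1..n} mu"
    and le: "\<forall>r\<in>{1..n}. mu r \<le> lam r"
    and L: "L \<in> LR n lam mu nu"
  shows "LR_profile n lam mu nu (row_end n lam mu L)"
proof -
  have ss: "semistandard n lam mu L" and yam: "yamanouchi (rev (reading_word n lam mu L))"
    and con: "has_content n lam mu L nu" using L by (auto simp: LR_def)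
  define p where "p = row_end n lam mu L"
  have ends: "has_row_ends n lam mu L p"
    unfolding p_def by (rule has_row_ends_row_end[OF ss le])
  have image: "L ` skew_shape n lam mu \<subseteq> {1..n}" using con by (simp add: has_content_def)
  have zero: "p r 0 = mu r" for r
  proof -
    have "{c. (r, c) \<in> skew_shape n lam mu \<and> L (r, c) \<le> 0} = {}" using image by fastforce
    then show ?thesis unfolding p_def row_end_def by (simp only: card.empty)
  qed
  have col: "p (r + 1) (m + 1) \<le> p r m" if r: "r \<in> {1..<n}" for r m
  proof (rule ccontr)
    assume "\<not> ?thesis"
    \<comment> \<open>If \<open>c\<close> lay beyond \<open>p r m\<close>, the box above
      \<open>(r + 1, c)\<close> would be in the shape by monotonicity of \<open>lam\<close>. Its
      entry would be \<open>\<le> m\<close> by column strictness, contradicting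
      \<open>p r m < c\<close>.\<close>
    define c where "c = p (r + 1) (m + 1)"
    have r': "r \<in> {1..n}" "r + 1 \<in> {1..n}" using r by auto
    have b: "mu r \<le> p r m" "c \<le> lam (r + 1)"
      using ends r' unfolding has_row_ends_def c_def by blast+
    have "mu (r + 1) \<le> mu r" "lam (r + 1) \<le> lam r"
      using monotone_onD[OF lam r'] monotone_onD[OF mu r'] by auto
    with b \<open>\<not> ?thesis\<close> have c: "c \<in> {mu r + 1..lam r}" "c \<in> {mu (r + 1) + 1..lam (r + 1)}" "p r m < c"
      by (auto simp: c_def)
    have "L (r + 1, c) \<le> m + 1"
      using ends r' c(2) unfolding has_row_ends_def by (metis c_def order_refl)
    moreover have "L (r, c) < L (r + 1, c)"
      using ss r' c unfolding semistandard_def by (auto simp: skew_shape_def)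
    ultimately have "L (r, c) \<le> m" by simp
    then have "c \<le> p r m" using ends r' c(1) unfolding has_row_ends_def by blast
    then show False using c(3) by simp
  qed
  have "\<forall>a<n. (\<Sum>r=1..n. p r (a + 1) - p r a) = nu (a + 1)"
    using con unfolding card_shape_level_set[OF ends, symmetric] by (simp add: has_content_def)
  moreover have "\<forall>r\<in>{1..n}. \<forall>m. p r m \<le> p r (m + 1)"
    using ends unfolding has_row_ends_def by blast
  ultimately show ?thesis
    using zero col yam row_end_flagged[OF ends yam image]
    unfolding LR_profile_def yamanouchi_reading_word_iff[OF ends] p_def[symmetric] by blast
qed

section \<open>From profiles back to LR tableaux\<close>

text \<open>The filling forced by \<open>has_row_ends\<close>: an entry is the least level whose row
  end reaches its column.\<close>

definition tableau_of ::
    "nat \<Rightarrow> (nat \<Rightarrow> int) \<Rightarrow> (nat \<Rightarrow> int) \<Rightarrow> (nat \<Rightarrow> nat \<Rightarrow> int) \<Rightarrow> nat \<times> int \<Rightarrow> nat" where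
  "tableau_of n lam mu p = (\<lambda>(r, c) \<in> skew_shape n lam mu. LEAST m. c \<le> p r m)"

lemma LR_profile_mono:
  assumes "LR_profile n lam mu nu p" "r \<in> {1..n}" "m \<le> m'"
  shows "p r m \<le> p r m'"
  using lift_Suc_mono_le[of "p r" m m'] assms by (simp add: LR_profile_def)

lemma tableau_of_row_ends:
  assumes p: "LR_profile n lam mu nu p"
  shows "has_row_ends n lam mu (tableau_of n lam mu p) p"
  unfolding has_row_ends_def
proof (intro ballI conjI allI)
  fix r m assume r: "r \<in> {1..n}"
  \<comment> \<open>Level \<open>m + r\<close> lies in the range where the profile equals
    \<open>lam r\<close>. It bounds \<open>p r m\<close> from above and shows that the
    \<open>LEAST\<close> below exists.\<close>
  have e: "p r 0 = mu r" "p r (m + r) = lam r" using p r by (auto simp: LR_profile_def)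
  show "mu r \<le> p r m" "p r m \<le> lam r" "p r m \<le> p r (m + 1)"
    using LR_profile_mono[OF p r, of 0 m] LR_profile_mono[OF p r, of m "m + r"]
      LR_profile_mono[OF p r, of m "m + 1"] e by auto
  fix c assume c: "c \<in> {mu r + 1..lam r}"
  then have eq: "tableau_of n lam mu p (r, c) = (LEAST m. c \<le> p r m)"
    using r by (simp add: tableau_of_def skew_shape_def)
  have "c \<le> p r (m + r)" using e c by simp
  then have "c \<le> p r (LEAST m. c \<le> p r m)" by (rule LeastI)
  then show "tableau_of n lam mu p (r, c) \<le> m \<longleftrightarrow> c \<le> p r m"
    unfolding eq using LR_profile_mono[OF p r] by (meson Least_le order_trans)
qed

lemma LR_profile_column:
  assumes p: "LR_profile n lam mu nu p" and "1 \<le> r" "r + k \<le> n"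
  shows "p (r + k) (m + k) \<le> p r m"
  using assms(3)
proof (induction k)
  case (Suc k)
  have "p (r + k + 1) (m + k + 1) \<le> p (r + k) (m + k)"
    using p assms(2) Suc.prems unfolding LR_profile_def by auto
  then show ?case using Suc by simp
qed simp

lemma tableau_of_LR:
  assumes p: "LR_profile n lam mu nu p"
  shows "tableau_of n lam mu p \<in> LR n lam mu nu"
proof -
  define L where "L = tableau_of n lam mu p"
  have ends: "has_row_ends n lam mu L p"
    unfolding L_def by (rule tableau_of_row_ends[OF p])
  have iff: "L (r, c) \<le> m \<longleftrightarrow> c \<le> p r m" if "(r, c) \<in> skew_shape n lam mu" for r c m
    using ends that unfolding has_row_ends_def by (auto simp: skew_shape_def)
  have range: "L (r, c) \<in> {1..n}" if rc: "(r, c) \<in> skew_shape n lam mu" for r c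
  proof -
    have r: "r \<in> {1..n}" and c: "mu r < c" "c \<le> lam r" using rc by (auto simp: skew_shape_def)
    have "p r 0 = mu r" "p r r = lam r" using p r by (auto simp: LR_profile_def)
    then have "\<not> L (r, c) \<le> 0" "L (r, c) \<le> r" using iff[OF rc] c by (metis not_le)+
    then show ?thesis using r by auto
  qed
  then have image: "L ` skew_shape n lam mu \<subseteq> {1..n}" by auto
  have tab: "L \<in> tableaux n lam mu"
    unfolding tableaux_def
  proof (rule PiE_I)
    show "L x \<in> {1..}" if "x \<in> skew_shape n lam mu" for x
      using range[of "fst x" "snd x"] that by simp
  qed (simp add: L_def tableau_of_def)
  have rows: "L (r, c) \<le> L (r, c')"
    if "(r, c) \<in> skew_shape n lam mu" "(r, c') \<in> skew_shape n lam mu" "c < c'" for r c c'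
    using iff[OF that(1)] iff[OF that(2)] that(3) by (meson order.refl order.strict_implies_order order.trans)
  have cols: "L (r, c) < L (r', c)"
    if rc: "(r, c) \<in> skew_shape n lam mu" "(r', c) \<in> skew_shape n lam mu" "r < r'" for r r' c
  proof -
    have r: "1 \<le> r" "r' \<le> n" "r' \<in> {1..n}" using rc by (auto simp: skew_shape_def)
    obtain m where m: "L (r', c) = m + 1" using range[OF rc(2)] by (metis Suc_eq_plus1 Suc_le_D atLeastAtMost_iff One_nat_def)
    have "c \<le> p r' (m + 1)" using iff[OF rc(2)] m by (metis order_refl)
    \<comment> \<open>The level is raised so that going up \<open>r' - r\<close> rows, losing one
      level per row, ends exactly at level \<open>m\<close>.\<close>
    also have "\<dots> \<le> p r' (m + (r' - r))" using LR_profile_mono[OF p r(3)] rc(3) by simp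
    also have "\<dots> \<le> p r m" using LR_profile_column[OF p r(1), of "r' - r" m] r rc(3) by simp
    finally have "L (r, c) \<le> m" using iff[OF rc(1)] by simp
    then show ?thesis using m by simp
  qed
  have ss: "semistandard n lam mu L" using rows cols unfolding semistandard_def by blast
  have "int (card {b \<in> skew_shape n lam mu. L b = k}) = nu k" if "k \<in> {1..n}" for k
  proof -
    from that have "k = k - 1 + 1" "k - 1 < n" by auto
    then obtain a where "k = a + 1" "a < n" by blast
    then show ?thesis using card_shape_level_set[OF ends, of a] p by (simp add: LR_profile_def)
  qed
  then have con: "has_content n lam mu L nu" using image by (simp add: has_content_def)
  have "yamanouchi (rev (reading_word n lam mu L))"
    unfolding yamanouchi_reading_word_iff[OF ends] using p unfolding LR_profile_def by blast
  then show ?thesis using tab ss con by (simp add: LR_def L_def)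
qed

section \<open>Arrays and the GZ conditions in terms of row ends\<close>

text \<open>This is \<open>phi\<close> in row-end coordinates. On the triangle only values
  \<open>p r m\<close> with \<open>m < r\<close> are read.\<close>

definition array_of :: "nat \<Rightarrow> (nat \<Rightarrow> nat \<Rightarrow> int) \<Rightarrow> nat \<times> nat \<Rightarrow> int" where
  "array_of n p = (\<lambda>(i, j) \<in> triangle n. - p (n + 1 - j) (n - i))"

lemma phi_eq_array_of: "phi n lam mu L = array_of n (row_end n lam mu L)"
  unfolding phi_def dual_array_def array_of_def
proof (intro restrict_ext, clarify)
  fix i j assume ij: "(i, j) \<in> triangle n"
  then have "(i, i + 1 - j) \<in> triangle n" "n - i + (i + 1 - j) = n + 1 - j"
    by (auto simp: triangle_def)
  then show "- U_array n lam mu L (i, i + 1 - j) = - row_end n lam mu L (n + 1 - j) (n - i)"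
    by (simp add: U_array_def row_end_def)
qed

lemma array_of_apply:
  assumes "m < r" "r \<le> n"
  shows "array_of n p (n - m, n + 1 - r) = - p r m"
  using assms by (auto simp: array_of_def triangle_def)

text \<open>Array row \<open>n - a\<close> lists the tableau rows \<open>r > a\<close> from the
  bottom up; sums along it thus become sums over tableau rows.\<close>

lemma sum_flip:
  fixes f g :: "nat \<Rightarrow> int"
  assumes "a \<le> n" "\<And>r. a < r \<Longrightarrow> r \<le> n \<Longrightarrow> f (n + 1 - r) = g r"
  shows "(\<Sum>k=1..n - a. f k) = (\<Sum>r\<in>{a<..n}. g r)"
proof (rule sum.reindex_bij_witness[of _ "\<lambda>r. n + 1 - r" "\<lambda>k. n + 1 - k"])
  fix k assume "k \<in> {1..n - a}"
  then have "a < n + 1 - k" "n + 1 - k \<le> n" "n + 1 - (n + 1 - k) = k" using assms(1) by auto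
  then show "g (n + 1 - k) = f k" using assms(2) by metis
qed (use assms(1) in auto)

lemma sum_row_split:
  fixes g :: "nat \<Rightarrow> int"
  assumes "a \<le> n"
  shows "(\<Sum>r=1..n. g r) = (\<Sum>r=1..a. g r) + (\<Sum>r\<in>{a<..n}. g r)"
proof -
  have "{1..n} = {1..a} \<union> {a<..n}" using assms by auto
  moreover have "{1..a} \<inter> {a<..n} = {}" by auto
  ultimately show ?thesis by (metis finite_atLeastAtMost finite_greaterThanAtMost sum.union_disjoint)
qed

text \<open>Two consecutive array rows differ by one tableau row, \<open>m + 1\<close>, whose end at
  level \<open>m + 1\<close> is \<open>lam (m + 1)\<close>. Rows up to \<open>m\<close> contain no
  letter \<open>m + 1\<close>, so the sum may run over all rows.\<close>

lemma array_weight_array_of: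
  assumes flag: "\<forall>r\<in>{1..n}. \<forall>m\<ge>r. p r m = lam r" and m: "m < n"
  shows "array_weight (array_of n p) (n - m) = (\<Sum>r=1..n. p r (m + 1) - p r m) - lam (m + 1)"
proof -
  let ?T = "array_of n p"
  have 1: "(\<Sum>k=1..n - m. ?T (n - m, k)) = (\<Sum>r\<in>{m<..n}. - p r m)"
    using m by (intro sum_flip array_of_apply) auto
  have 2: "(\<Sum>k=1..n - m - 1. ?T (n - m - 1, k)) = (\<Sum>r\<in>{m + 1<..n}. - p r (m + 1))"
    using m array_of_apply[of "m + 1" _ n p]
    by (subst diff_diff_add, intro sum_flip) (auto simp: diff_diff_add)
  have "{m<..n} = insert (m + 1) {m + 1<..n}" using m by auto
  then have 3: "(\<Sum>r\<in>{m<..n}. p r (m + 1)) = lam (m + 1) + (\<Sum>r\<in>{m + 1<..n}. p r (m + 1))"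
    using flag m by simp
  have "(\<Sum>r=1..m. p r (m + 1) - p r m) = 0"
    using flag m by (intro sum.neutral) auto
  then have "(\<Sum>r=1..n. p r (m + 1) - p r m) = (\<Sum>r\<in>{m<..n}. p r (m + 1)) - (\<Sum>r\<in>{m<..n}. p r m)"
    using m sum_row_split[of m n "\<lambda>r. p r (m + 1) - p r m"] by (simp add: sum_subtractf)
  then show ?thesis
    unfolding array_weight_def 1 2 3 by (simp add: sum_negf)
qed

text \<open>The exponent involves only rows from \<open>R\<close> down; these sums are totals minus
  sums over the upper rows. Given the content, the first bracket is
  \<open>nu (a + 1) - nu (a + 2)\<close>; the second is the slack of the Yamanouchi inequality at
  \<open>R\<close>.\<close>

lemma exponent_array_of:
  assumes "a + 1 < R" "R \<le> n"
  shows "exponent (array_of n p) (n - (a + 1)) (n + 1 - R) =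
    ((\<Sum>r=1..n. p r (a + 1) - p r a) - (\<Sum>r=1..n. p r (a + 2) - p r (a + 1))) -
    ((\<Sum>r=1..<R. p r (a + 1) - p r a) - (\<Sum>r=1..R. p r (a + 2) - p r (a + 1)))"
proof -
  let ?T = "array_of n p"
  let ?c = "\<lambda>r. p r (a + 1) - p r a" and ?d = "\<lambda>r. p r (a + 2) - p r (a + 1)"
  have i: "n - (a + 1) + 1 = n - a" "n - (a + 1) - 1 = n - (a + 2)" using assms by auto
  have "{1..<n + 1 - R} = {1..n - R}" using assms by auto
  then have "(\<Sum>h=1..<n + 1 - R. ?T (n - a, h) - 2 * ?T (n - (a + 1), h) + ?T (n - (a + 2), h))
      = (\<Sum>r\<in>{R<..n}. ?c r - ?d r)"
    using assms array_of_apply[of a _ n p] array_of_apply[of "a + 1" _ n p] array_of_apply[of "a + 2" _ n p]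
    by (simp only:, intro sum_flip) auto
  moreover have "?T (n - a, n + 1 - R) - ?T (n - (a + 1), n + 1 - R) = ?c R"
    using assms array_of_apply[of a R n p] array_of_apply[of "a + 1" R n p] by simp
  moreover have "(\<Sum>r=1..R. ?c r) = (\<Sum>r=1..<R. ?c r) + ?c R"
    using assms by (cases R) (auto simp: atLeastLessThanSuc_atLeastAtMost)
  moreover have "(\<Sum>r=1..n. ?c r) = (\<Sum>r=1..R. ?c r) + (\<Sum>r\<in>{R<..n}. ?c r)"
    "(\<Sum>r=1..n. ?d r) = (\<Sum>r=1..R. ?d r) + (\<Sum>r\<in>{R<..n}. ?d r)"
    using assms by (intro sum_row_split; simp)+
  ultimately show ?thesis
    unfolding exponent_def i sum_subtractf[of ?c ?d] by linarith
qed

text \<open>The substitution \<open>i = n - (a + 1)\<close>, \<open>j = n + 1 - R\<close>; on these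
  ranges the truncated subtractions are exact.\<close>

lemma all_triangle_iff:
  fixes n :: nat
  shows "(\<forall>i j. 1 \<le> j \<and> j \<le> i \<and> i \<le> n - 1 \<longrightarrow> P i j) \<longleftrightarrow>
   (\<forall>a R. a + 1 < R \<and> R \<le> n \<longrightarrow> P (n - (a + 1)) (n + 1 - R))"
proof (intro iffI allI impI)
  fix a R :: nat
  assume "\<forall>i j. 1 \<le> j \<and> j \<le> i \<and> i \<le> n - 1 \<longrightarrow> P i j" "a + 1 < R \<and> R \<le> n"
  moreover from this(2) have "1 \<le> n + 1 - R" "n + 1 - R \<le> n - (a + 1)" "n - (a + 1) \<le> n - 1"
    by auto
  ultimately show "P (n - (a + 1)) (n + 1 - R)" by blast
next
  fix i j :: nat
  assume P: "\<forall>a R. a + 1 < R \<and> R \<le> n \<longrightarrow> P (n - (a + 1)) (n + 1 - R)" and ij: "1 \<le> j \<and> j \<le> i \<and> i \<le> n - 1"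
  define a R where "a = n - (i + 1)" and "R = n + 1 - j"
  have "a + 1 < R \<and> R \<le> n" and eq: "n - (a + 1) = i" "n + 1 - R = j"
    using ij by (auto simp: a_def R_def)
  then have "P (n - (a + 1)) (n + 1 - R)" using P by blast
  then show "P i j" unfolding eq .
qed

lemma ball_flip:
  fixes n :: nat
  shows "(\<forall>i\<in>{1..n}. P i) \<longleftrightarrow> (\<forall>r\<in>{1..n}. P (n + 1 - r))"
proof (intro iffI ballI)
  fix i assume "\<forall>r\<in>{1..n}. P (n + 1 - r)" "i \<in> {1..n}"
  moreover from this(2) have "n + 1 - i \<in> {1..n}" "n + 1 - (n + 1 - i) = i" by auto
  ultimately show "P i" by metis
next
  fix r assume P: "\<forall>i\<in>{1..n}. P i" and r: "r \<in> {1..n}"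
  have "n + 1 - r \<in> {1..n}" using r by auto
  then show "P (n + 1 - r)" using P by blast
qed

lemma ball_diff_iff:
  fixes n :: nat
  shows "(\<forall>i\<in>{1..n}. P i) \<longleftrightarrow> (\<forall>a<n. P (n - a))"
proof (intro iffI ballI allI impI)
  fix i assume "\<forall>a<n. P (n - a)" "i \<in> {1..n}"
  moreover from this(2) have "n - i < n" "n - (n - i) = i" by auto
  ultimately show "P i" by metis
qed auto

text \<open>Clause by clause, the GT inequalities become row and column conditions, the type becomes
  level \<open>0\<close>, the weight becomes the content, and the exponent bounds become the
  Yamanouchi inequalities.\<close>

lemma array_of_GZ_iff:
  assumes flag: "\<forall>r\<in>{1..n}. \<forall>m\<ge>r. p r m = lam r"
  shows "array_of n p \<in> GZ n (dual_weight n mu) (\<lambda>i. dual_weight n lam i - dual_weight n nu i)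
      (dual_weight n nu) \<longleftrightarrow>
    (\<forall>a R. a + 1 < R \<and> R \<le> n \<longrightarrow> p R a \<le> p R (a + 1) \<and> p R (a + 1) \<le> p (R - 1) a) \<and>
    (\<forall>r\<in>{1..n}. p r 0 = mu r) \<and>
    (\<forall>a<n. (\<Sum>r=1..n. p r (a + 1) - p r a) = nu (a + 1)) \<and>
    (\<forall>a R. a + 1 < R \<and> R \<le> n \<longrightarrow>
      (\<Sum>r=1..R. p r (a + 2) - p r (a + 1)) \<le> (\<Sum>r=1..<R. p r (a + 1) - p r a))"
proof -
  let ?T = "array_of n p"
  have arr: "?T \<in> t_arrays n" by (simp add: t_arrays_def array_of_def)
  have gt: "gt_pattern n ?T \<longleftrightarrow>
      (\<forall>a R. a + 1 < R \<and> R \<le> n \<longrightarrow> p R a \<le> p R (a + 1) \<and> p R (a + 1) \<le> p (R - 1) a)"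
    unfolding gt_pattern_def all_triangle_iff
  proof (intro arg_cong[of _ _ All] ext imp_cong[OF refl])
    fix a R assume aR: "a + 1 < R \<and> R \<le> n"
    have i: "n - (a + 1) + 1 = n - a" "n + 1 - R + 1 = n + 1 - (R - 1)" using aR by auto
    have e: "?T (n - a, n + 1 - R) = - p R a" "?T (n - (a + 1), n + 1 - R) = - p R (a + 1)"
      "?T (n - a, n + 1 - (R - 1)) = - p (R - 1) a"
      by (intro array_of_apply; use aR in linarith)+
    show "(?T (n - (a + 1), n + 1 - R) \<le> ?T (n - (a + 1) + 1, n + 1 - R) \<and>
        ?T (n - (a + 1) + 1, n + 1 - R + 1) \<le> ?T (n - (a + 1), n + 1 - R)) \<longleftrightarrow>
        p R a \<le> p R (a + 1) \<and> p R (a + 1) \<le> p (R - 1) a"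
      unfolding i e by linarith
  qed
  have type: "(\<forall>j\<in>{1..n}. ?T (n, j) = dual_weight n mu j) \<longleftrightarrow> (\<forall>r\<in>{1..n}. p r 0 = mu r)"
    unfolding ball_flip[of n "\<lambda>j. ?T (n, j) = dual_weight n mu j"]
    using array_of_apply[of 0 _ n p] by (intro ball_cong[OF refl]) (auto simp: dual_weight_def)
  have weight: "(\<forall>i\<in>{1..n}. array_weight ?T i = dual_weight n lam i - dual_weight n nu i) \<longleftrightarrow>
      (\<forall>a<n. (\<Sum>r=1..n. p r (a + 1) - p r a) = nu (a + 1))"
    unfolding ball_diff_iff
  proof (intro arg_cong[of _ _ All] ext imp_cong[OF refl])
    fix a assume a: "a < n"
    then have "n + 1 - (n - a) = a + 1" by simp
    then show "(array_weight ?T (n - a) = dual_weight n lam (n - a) - dual_weight n nu (n - a)) \<longleftrightarrow>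
        (\<Sum>r=1..n. p r (a + 1) - p r a) = nu (a + 1)"
      unfolding array_weight_array_of[OF flag a] dual_weight_def by auto
  qed
  have exponents: "(\<forall>i j. 1 \<le> j \<and> j \<le> i \<and> i \<le> n - 1 \<longrightarrow>
        exponent ?T i j \<le> dual_weight n nu i - dual_weight n nu (i + 1)) \<longleftrightarrow>
      (\<forall>a R. a + 1 < R \<and> R \<le> n \<longrightarrow>
        (\<Sum>r=1..R. p r (a + 2) - p r (a + 1)) \<le> (\<Sum>r=1..<R. p r (a + 1) - p r a))"
    \<comment> \<open>The content is what replaces the totals in the exponent formula by values of
      \<open>nu\<close>.\<close>
    if content: "\<forall>a<n. (\<Sum>r=1..n. p r (a + 1) - p r a) = nu (a + 1)"
    unfolding all_triangle_iff
  proof (intro arg_cong[of _ _ All] ext imp_cong[OF refl])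
    fix a R assume aR: "a + 1 < R \<and> R \<le> n"
    then have "n + 1 - (n - (a + 1)) = a + 2" "n + 1 - (n - (a + 1) + 1) = a + 1" by auto
    moreover have "(\<Sum>r=1..n. p r (a + 1) - p r a) = nu (a + 1)"
      "(\<Sum>r=1..n. p r (a + 2) - p r (a + 1)) = nu (a + 2)"
      using content[rule_format, of a] content[rule_format, of "a + 1"] aR by (auto simp: add.assoc)
    ultimately show "(exponent ?T (n - (a + 1)) (n + 1 - R)
        \<le> dual_weight n nu (n - (a + 1)) - dual_weight n nu (n - (a + 1) + 1)) \<longleftrightarrow>
        (\<Sum>r=1..R. p r (a + 2) - p r (a + 1)) \<le> (\<Sum>r=1..<R. p r (a + 1) - p r a)"
      using aR by (simp only: exponent_array_of dual_weight_def) linarith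
  qed
  show ?thesis
    unfolding GZ_def mem_Collect_eq gt type weight using arr exponents by blast
qed

lemma LR_profile_array_of:
  assumes "LR_profile n lam mu nu p"
  shows "array_of n p \<in> GZ n (dual_weight n mu) (\<lambda>i. dual_weight n lam i - dual_weight n nu i)
    (dual_weight n nu)"
proof -
  have "p R (a + 1) \<le> p (R - 1) a" if "a + 1 < R" "R \<le> n" for a R
    using LR_profile_column[OF assms, of "R - 1" 1 a] that by simp
  moreover have "p R a \<le> p R (a + 1)" if "a + 1 < R" "R \<le> n" for a R
    using LR_profile_mono[OF assms, of R a "a + 1"] that by simp
  moreover have flag: "\<forall>r\<in>{1..n}. \<forall>m\<ge>r. p r m = lam r"
    using assms by (simp add: LR_profile_def)
  ultimately show ?thesis
    using assms by (intro iffD2[OF array_of_GZ_iff[OF flag]]) (auto simp: LR_profile_def)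
qed

text \<open>The pattern says nothing about the number of entries \<open>r\<close> in row \<open>r\<close>; that these numbers are
  nonnegative follows from \<open>0 \<le> nu n\<close>, since by the exponent condition they decrease in \<open>r\<close>.\<close>

lemma GZ_LR_profile:
  assumes lam: "antimono_on {1..n} lam" and nu: "\<forall>i\<in>{1..n}. 0 \<le> nu i"
    and flag: "\<forall>r\<in>{1..n}. \<forall>m\<ge>r. p r m = lam r"
    and T: "array_of n p \<in> GZ n (dual_weight n mu)
      (\<lambda>i. dual_weight n lam i - dual_weight n nu i) (dual_weight n nu)"
  shows "LR_profile n lam mu nu p"
proof -
  note GZ = iffD1[OF array_of_GZ_iff[OF flag] T]
  have content: "(\<Sum>r=1..n. p r (a + 1) - p r a) = nu (a + 1)" if "a < n" for a
    using GZ that by blast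
  have yam: "(\<Sum>r=1..R. p r (a + 2) - p r (a + 1)) \<le> (\<Sum>r=1..<R. p r (a + 1) - p r a)"
    if R: "R \<in> {1..n}" for R a
  proof (cases "a + 1 < R")
    case True
    then show ?thesis using GZ R by auto
  next
    case False
    \<comment> \<open>Outside the triangle every level involved is at least its row index, so all
      differences vanish.\<close>
    then have "(\<Sum>r=1..R. p r (a + 2) - p r (a + 1)) = 0" "(\<Sum>r=1..<R. p r (a + 1) - p r a) = 0"
      using R flag by (auto intro!: sum.neutral)
    then show ?thesis by simp
  qed
  \<comment> \<open>Rows up to \<open>k\<close> contribute nothing to letter \<open>k + 1\<close>,
    so only the last row survives.\<close>
  have diag: "(\<Sum>r=1..k + 1. p r (k + 1) - p r k) = p (k + 1) (k + 1) - p (k + 1) k" if "k < n" for k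
  proof -
    have "(\<Sum>r=1..k. p r (k + 1) - p r k) = 0" using that flag by (intro sum.neutral) auto
    then show ?thesis by simp
  qed
  have diag_nonneg: "0 \<le> p (n - k) (n - k) - p (n - k) (n - k - 1)" if "k < n" for k
    using that
  proof (induction k)
    case 0
    then show ?case using diag[of "n - 1"] content[of "n - 1"] nu by simp
  next
    case (Suc k)
    \<comment> \<open>Row \<open>a + 2\<close> is already settled and row \<open>a + 1\<close> comes
      next. By \<open>diag\<close>, the Yamanouchi inequality at \<open>R = a + 2\<close> compares
      exactly their diagonal multiplicities.\<close>
    define a where "a = n - Suc k - 1"
    have a: "n - k = a + 2" "n - Suc k = a + 1" "a + 2 \<le> n" using Suc.prems by (auto simp: a_def)
    have "p (a + 2) (a + 2) - p (a + 2) (a + 1) \<le> p (a + 1) (a + 1) - p (a + 1) a"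
      using yam[of "a + 2" a] diag[of "a + 1"] diag[of a] a
      by (simp add: atLeastLessThanSuc_atLeastAtMost)
    then show ?case using Suc a by simp
  qed
  have mono: "p r m \<le> p r (m + 1)" if r: "r \<in> {1..n}" for r m
  proof -
    consider "m + 1 < r" | "m + 1 = r" | "r \<le> m" by linarith
    then show ?thesis
    proof cases
      case 1
      then show ?thesis using GZ r by auto
    next
      case 2
      then show ?thesis using diag_nonneg[of "n - r"] r by auto
    next
      case 3
      then show ?thesis using flag r by simp
    qed
  qed
  have col: "p (r + 1) (m + 1) \<le> p r m" if r: "r \<in> {1..<n}" for r m
  proof (cases "m < r")
    case True
    then have "m + 1 < r + 1 \<and> r + 1 \<le> n" using r by simp
    then have "p (r + 1) (m + 1) \<le> p (r + 1 - 1) m" using GZ by blast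
    then show ?thesis by simp
  next
    case False
    \<comment> \<open>Here both levels are in the flagged range, and the claim is
      \<open>lam (r + 1) \<le> lam r\<close>.\<close>
    then show ?thesis using flag r monotone_onD[OF lam, of r "r + 1"] by simp
  qed
  have "\<forall>r\<in>{1..n}. p r 0 = mu r" using GZ by blast
  then show ?thesis
    unfolding LR_profile_def by (intro conjI ballI allI impI) (use flag mono col content yam in simp_all)
qed

section \<open>The bijection\<close>

text \<open>An array fixes \<open>p r m\<close> only for \<open>m < r\<close>; the other values are
  set to \<open>lam r\<close>, as a profile requires.\<close>

lemma array_of_surj:
  assumes "T \<in> t_arrays n"
  shows "array_of n (\<lambda>r m. if m < r then - T (n - m, n + 1 - r) else lam r) = T"
proof
  fix x
  show "array_of n (\<lambda>r m. if m < r then - T (n - m, n + 1 - r) else lam r) x = T x"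
    using assms by (cases x) (auto simp: array_of_def t_arrays_def triangle_def PiE_def extensional_def)
qed

theorem theorem4p4:
  fixes n :: nat and lam mu nu :: "nat \<Rightarrow> int"
  assumes "n \<ge> 1"
    and "polynomial_dominant_weight n lam"
    and "polynomial_dominant_weight n mu"
    and "polynomial_dominant_weight n nu"
    and "\<forall>i\<in>{1..n}. mu i \<le> lam i"
  shows "bij_betw (phi n lam mu) (LR n lam mu nu)
    (GZ n (dual_weight n mu) (\<lambda>i. dual_weight n lam i - dual_weight n nu i) (dual_weight n nu))"
    (is "bij_betw _ _ ?GZ")
proof -
  have lam: "antimono_on {1..n} lam" and mu: "antimono_on {1..n} mu"
    and nu: "\<forall>i\<in>{1..n}. 0 \<le> nu i"
    using assms by (auto simp: polynomial_dominant_weight_def)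
  have profile: "LR_profile n lam mu nu (row_end n lam mu L)" if "L \<in> LR n lam mu nu" for L
    using LR_profile_row_end[OF lam mu assms(5) that] .
  have ends: "has_row_ends n lam mu L (row_end n lam mu L)" if "L \<in> LR n lam mu nu" for L
    using that assms(5) by (intro has_row_ends_row_end) (auto simp: LR_def)
  have inj: "inj_on (phi n lam mu) (LR n lam mu nu)"
  proof
    fix L L' assume L: "L \<in> LR n lam mu nu" "L' \<in> LR n lam mu nu" and eq: "phi n lam mu L = phi n lam mu L'"
    let ?p = "row_end n lam mu L" and ?p' = "row_end n lam mu L'"
    \<comment> \<open>For \<open>m < r\<close> the value is read off the common array; otherwise
      both row ends equal \<open>lam r\<close>.\<close>
    have p: "?p r m = ?p' r m" if "r \<in> {1..n}" for r m
    proof (cases "m < r")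
      case True
      then show ?thesis
        using that eq array_of_apply[of m r n ?p] array_of_apply[of m r n ?p']
        by (simp add: phi_eq_array_of)
    next
      case False
      then show ?thesis using that profile[OF L(1)] profile[OF L(2)] by (simp add: LR_profile_def)
    qed
    show "L = L'"
    proof (rule PiE_ext)
      show "L \<in> skew_shape n lam mu \<rightarrow>\<^sub>E {1..}" "L' \<in> skew_shape n lam mu \<rightarrow>\<^sub>E {1..}"
        using L by (auto simp: LR_def tableaux_def)
      fix x assume "x \<in> skew_shape n lam mu"
      then obtain r c where x: "x = (r, c)" "r \<in> {1..n}" "c \<in> {mu r + 1..lam r}"
        by (auto simp: skew_shape_def)
      have "L x \<le> m \<longleftrightarrow> L' x \<le> m" for m
        using ends[OF L(1)] ends[OF L(2)] p x unfolding has_row_ends_def by auto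
      then show "L x = L' x" by (meson order.antisym order_refl)
    qed
  qed
  have "phi n lam mu ` LR n lam mu nu = ?GZ"
  proof
    show "phi n lam mu ` LR n lam mu nu \<subseteq> ?GZ"
      using LR_profile_array_of[OF profile] by (auto simp: phi_eq_array_of)
    show "?GZ \<subseteq> phi n lam mu ` LR n lam mu nu"
    proof
      fix T assume T: "T \<in> ?GZ"
      define p where "p = (\<lambda>r m. if m < r then - T (n - m, n + 1 - r) else lam r)"
      have arr: "array_of n p = T" using array_of_surj[of T n lam] T by (simp add: p_def GZ_def)
      have prof: "LR_profile n lam mu nu p"
        using T by (intro GZ_LR_profile[OF lam nu]) (simp_all add: arr, simp add: p_def)
      let ?L = "tableau_of n lam mu p"
      \<comment> \<open>The row ends of the constructed tableau are \<open>p\<close> in rows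
        \<open>1\<close> to \<open>n\<close>, the only rows that the array reads.\<close>
      have "phi n lam mu ?L = array_of n p"
        unfolding phi_eq_array_of array_of_def
      proof (intro restrict_ext, clarify)
        fix i j assume "(i, j) \<in> triangle n"
        then have "n + 1 - j \<in> {1..n}" by (auto simp: triangle_def)
        then show "- row_end n lam mu ?L (n + 1 - j) (n - i) = - p (n + 1 - j) (n - i)"
          using row_end_eqI[OF tableau_of_row_ends[OF prof]] by simp
      qed
      then show "T \<in> phi n lam mu ` LR n lam mu nu"
        using tableau_of_LR[OF prof] arr by (metis image_eqI)
    qed
  qed
  then show ?thesis using inj by (simp add: bij_betw_def)
qed

end
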